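(* Consider the closed-loop input-constrained ESC system described in the context, under its Assumptions 1, 2 and 3. Given a scalar $\eta>0$, if there exist a symmetric positive definite matrix $P\in\mathbb{R}^{n\times n}$, a diagonal positive definite matrix $\Lambda\in\mathbb{R}^{n\times n}$, and matrices $Z,Z_{\mathrm{aw}}\in\mathbb{R}^{n\times n}$ such that $$\begin{bmatrix} ZH_i+H_iZ^\top+2\eta P & \star\\ \Lambda-Z_{\mathrm{aw}}^\top-H_iZ^\top & -2\Lambda\end{bmatrix}<0,\qquad i=1,\dots,N,$$ then the origin of the average closed-loop system $$\dot{\tilde\theta}_{\mathrm{av}}(t)=KH\tilde\theta_{\mathrm{av}}(t)-KH\psi(\theta_{\mathrm{av}}(t))-K_{\mathrm{aw}}\psi(\theta_{\mathrm{av}}(t)),\qquad \theta_{\mathrm{av}}(t)=\tilde\theta_{\mathrm{av}}(t)+\theta^*,$$ with $K=P^{-1}Z$ and $K_{\mathrm{aw}}=P^{-1}Z_{\mathrm{aw}}$, is globally exponentially stable with decay rate $\eta$, that is, $$\|\tilde\theta_{\mathrm{av}}(t)\|\le\kappa e^{-\eta t}\|\tilde\theta_{\mathrm{av}}(0)\|,\qquad \kappa=\sqrt{\lambda_{\max}(P)/\lambda_{\min}(P)}.$$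
   Context: Notation: for symmetric matrices, $X>0$ ($X<0$) means positive (negative) definite; $\star$ denotes the block determined by symmetry; $\lambda_{\max},\lambda_{\min}$ are the extreme eigenvalues. Saturation: $\mathrm{sat}:\mathbb{R}^n\to\mathbb{R}^n$ acts element-wise, $\mathrm{sat}(\theta)_\ell=\mathrm{sign}(\theta_\ell)\min(|\theta_\ell|,\overline\theta_\ell)$ with bounds $\overline\theta_\ell>0$. Dead-zone: $\psi(\theta)=\theta-\mathrm{sat}(\theta)$. ESC system: $\theta(t)=\hat\theta(t)+S(t)$, $y(t)=Q^*+\frac12(\mathrm{sat}(\theta(t))-\theta^* )^\top H(\mathrm{sat}(\theta(t))-\theta^* )$, $\hat G(t)=M(t)y(t)$, $\dot{\hat\theta}(t)=K\hat G(t)-K_{\mathrm{aw}}\psi(\theta(t))$, $\tilde\theta=\hat\theta-\theta^*$, where $Q^*\in\mathbb{R}$, $\theta^*\in\mathbb{R}^n$ and the symmetric Hessian $H\in\mathbb{R}^{n\times n}$ are unknown, $S(t)=[a_1\sin(\omega_1t)\ \cdots\ a_n\sin(\omega_nt)]^\top$, $M(t)=[\frac{2}{a_1}\sin(\omega_1t)\ \cdots\ \frac{2}{a_n}\sin(\omega_nt)]^\top$, $a_i\ne0$. Its average closed-loop system is the autonomous system displayed in the claim. Assumption 1: $|\theta^*_\ell|<\overline\theta_\ell$ for $\ell=1,\dots,n$. Assumption 2: for a given $\omega>0$, $\omega_i=\omega_i'\omega$ with $\omega_i'$ rational and $\omega_i'\notin\{\omega_j',\ \tfrac12(\omega_j'+\omega_k'),\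 \omega_j'+2\omega_k',\ \omega_k'\pm\omega_l'\}$ for all distinct $i,j,k,l\in\{1,\dots,n\}$. Assumption 3: $H\in\mathrm{co}\{H_1,\dots,H_N\}$, the convex hull of known symmetric matrices $H_i$; i.e. $H=\sum_{i=1}^N\alpha_iH_i$ with unknown fixed $\alpha_i\ge0$, $\sum_i\alpha_i=1$. *)

theory Defs
  imports "HOL-Analysis.Analysis"
begin

definition symmetric_matrix :: "real^'n^'n \<Rightarrow> bool" where
  "symmetric_matrix A \<longleftrightarrow> transpose A = A"

definition positive_definite :: "real^'n^'n \<Rightarrow> bool" where
  "positive_definite A \<longleftrightarrow> symmetric_matrix A \<and> (\<forall>x. x \<noteq> 0 \<longrightarrow> x \<bullet> (A *v x) > 0)"

definition negative_definite :: "real^'n^'n \<Rightarrow> bool" where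
  "negative_definite A \<longleftrightarrow> symmetric_matrix A \<and> (\<forall>x. x \<noteq> 0 \<longrightarrow> x \<bullet> (A *v x) < 0)"

definition diagonal_matrix :: "real^'n^'n \<Rightarrow> bool" where
  "diagonal_matrix A \<longleftrightarrow> (\<forall>i j. i \<noteq> j \<longrightarrow> A $ i $ j = 0)"

definition eigenvalues :: "real^'n^'n \<Rightarrow> real set" where
  "eigenvalues A = {l. \<exists>v. v \<noteq> 0 \<and> A *v v = l *\<^sub>R v}"

text \<open>The set of eigenvalues is always finite, and it is nonempty when the matrix is symmetric;
  the two functions below are only meant for symmetric matrices.\<close>

definition lambda_max :: "real^'n^'n \<Rightarrow> real" where
  "lambda_max A = Max (eigenvalues A)"

definition lambda_min :: "real^'n^'n \<Rightarrow> real" where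
  "lambda_min A = Min (eigenvalues A)"

text \<open>The 2x2 block matrix with diagonal blocks \<open>A\<close>, \<open>C\<close>, lower left block \<open>B\<close>, and
  upper right block \<open>transpose B\<close>, with the sum type as index type.\<close>

definition star_block ::
    "real^'n^'n \<Rightarrow> real^'n^'n \<Rightarrow> real^'n^'n \<Rightarrow> real^('n + 'n)^('n + 'n)" where
  "star_block A B C = (\<chi> r c.
     case r of
       Inl i \<Rightarrow> (case c of Inl j \<Rightarrow> A $ i $ j | Inr j \<Rightarrow> transpose B $ i $ j)
     | Inr i \<Rightarrow> (case c of Inl j \<Rightarrow> B $ i $ j | Inr j \<Rightarrow> C $ i $ j))"

definition sat :: "real^'n \<Rightarrow> real^'n \<Rightarrow> real^'n" where
  "sat tb th = (\<chi> l. sgn (th $ l) * min \<bar>th $ l\<bar> (tb $ l))"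

definition dead_zone :: "real^'n \<Rightarrow> real^'n \<Rightarrow> real^'n" where
  "dead_zone tb th = th - sat tb th"

text \<open>Admissible probing frequencies \<open>wi $ i = w' i * w\<close> with \<open>w' i\<close> rational.  Each
  exclusion is required for all pairwise distinct tuples of the indices that occur in it,
  so that, for instance, the frequencies are pairwise distinct in every dimension.\<close>

definition admissible_frequencies :: "real \<Rightarrow> real^'n \<Rightarrow> bool" where
  "admissible_frequencies w wi \<longleftrightarrow> (\<exists>w' :: 'n \<Rightarrow> rat.
     (\<forall>i. wi $ i = of_rat (w' i) * w) \<and>
     (\<forall>i j. i \<noteq> j \<longrightarrow> w' i \<noteq> w' j) \<and>
     (\<forall>i j k. distinct [i, j, k] \<longrightarrow>
        w' i \<noteq> (w' j + w' k) / 2 \<and>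
        w' i \<noteq> w' j + 2 * w' k \<and>
        w' i \<noteq> w' j + w' k \<and>
        w' i \<noteq> w' j - w' k))"

text \<open>The right-hand side of the average closed loop, as a function of the estimation error
  \<open>x\<close>: the averaged variable is \<open>x + ts\<close>, where \<open>ts\<close> is the unknown extremum.\<close>

definition esc_average_field ::
    "real^'n^'n \<Rightarrow> real^'n \<Rightarrow> real^'n \<Rightarrow> real^'n^'n \<Rightarrow> real^'n^'n \<Rightarrow> real^'n \<Rightarrow> real^'n" where
  "esc_average_field H ts tb K Kaw x =
     (K ** H) *v x - (K ** H) *v dead_zone tb (x + ts) - Kaw *v dead_zone tb (x + ts)"

definition solves_autonomous_ode ::
    "('a::real_normed_vector \<Rightarrow> 'a) \<Rightarrow> (real \<Rightarrow> 'a) \<Rightarrow> real set \<Rightarrow> bool" where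
  "solves_autonomous_ode f x J \<longleftrightarrow> (\<forall>t\<in>J. (x has_vector_derivative f (x t)) (at t within J))"

text \<open>The origin is an equilibrium, and the exponential bound holds along every solution that
  starts at time 0, from any initial value and on any interval of existence: \<open>[0,T]\<close>, \<open>[0,T)\<close>
  or \<open>[0,\<infinity>)\<close>.\<close>

definition origin_globally_exponentially_stable ::
    "('a::real_normed_vector \<Rightarrow> 'a) \<Rightarrow> real \<Rightarrow> real \<Rightarrow> bool" where
  "origin_globally_exponentially_stable f \<kappa> \<eta> \<longleftrightarrow>
     f 0 = 0 \<and>
     (\<forall>x J. is_interval J \<and> 0 \<in> J \<and> J \<subseteq> {0..} \<and> solves_autonomous_ode f x J \<longrightarrow>
        (\<forall>t\<in>J. norm (x t) \<le> \<kappa> * exp (- \<eta> * t) * norm (x 0)))"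

end

theory Submission
  imports Defs
begin

text \<open>Along a solution \<open>x\<close>, write \<open>q\<close> for the dead zone of \<open>x + ts\<close> and \<open>V = x \<bullet> P x\<close>. The
  quadratic form of the matrix inequality, which is affine in the Hessian and hence nonpositive for
  \<open>H\<close> itself, evaluated at \<open>(x, q)\<close> is \<open>V' + 2 \<eta> V + 2 q \<bullet> \<Lambda> (x - q)\<close>. The last term is
  nonnegative because \<open>x - q\<close> is the saturation of \<open>x + ts\<close> minus \<open>ts\<close>, and \<open>ts\<close> lies within
  the saturation bounds. So \<open>exp (2 \<eta> t) V\<close> is nonincreasing, and the extreme eigenvalues of \<open>P\<close>
  compare \<open>V\<close> with the squared norm.\<close>

section \<open>Symmetric matrices and their extreme eigenvalues\<close>

lemma inner_matrix_transpose:
  fixes A :: "real^'n^'m"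
  shows "x \<bullet> (A *v y) = (transpose A *v x) \<bullet> y"
  by (simp add: transpose_matrix_vector dot_lmul_matrix)

lemma inner_symmetric_matrix:
  assumes "symmetric_matrix A"
  shows "x \<bullet> (A *v y) = y \<bullet> (A *v x)"
  using assms inner_matrix_transpose[of x A y] by (simp add: symmetric_matrix_def inner_commute)

lemma symmetric_matrix_scaleR_add_mat:
  assumes "symmetric_matrix A"
  shows "symmetric_matrix (c *\<^sub>R A + mat d)"
  using assms
  by (simp add: symmetric_matrix_def transpose_def vec_eq_iff mat_def)

text \<open>If \<open>u = A *v v\<close> were nonzero, a small step from \<open>v\<close> against
  \<open>u\<close> would make the form negative: its value at \<open>v - s u\<close> is
  \<open>- 2 s (u \<bullet> u) + s^2 b\<close> with \<open>b = u \<bullet> (A *v u)\<close>.\<close>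

lemma semidefinite_null_vector:
  fixes A :: "real^'n^'n"
  assumes sym: "symmetric_matrix A" and nonneg: "\<And>x. x \<bullet> (A *v x) \<ge> 0"
    and zero: "v \<bullet> (A *v v) = 0"
  shows "A *v v = 0"
proof (rule ccontr)
  define u where "u = A *v v"
  assume "A *v v \<noteq> 0"
  then have pos: "u \<bullet> u > 0" by (simp add: u_def)
  define b where "b = u \<bullet> (A *v u)"
  have b: "b \<ge> 0" unfolding b_def by (rule nonneg)
  \<comment> \<open>Small enough that \<open>s * b\<close> stays below
    \<open>2 * (u \<bullet> u)\<close>; the added 1 keeps the denominator positive when
    \<open>b = 0\<close>.\<close>
  define s where "s = (u \<bullet> u) / (b + 1)"
  have s: "s > 0" using pos b by (simp add: s_def)
  have vAu: "v \<bullet> (A *v u) = u \<bullet> u"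
    using inner_symmetric_matrix[OF sym, of v u] by (simp add: u_def)
  have "0 \<le> (v - s *\<^sub>R u) \<bullet> (A *v (v - s *\<^sub>R u))" by (rule nonneg)
  also have "A *v (v - s *\<^sub>R u) = u - s *\<^sub>R (A *v u)"
    by (simp add: matrix_vector_mult_diff_distrib matrix_vector_mult_scaleR u_def)
  also have "(v - s *\<^sub>R u) \<bullet> (u - s *\<^sub>R (A *v u))
      = v \<bullet> u - s * (v \<bullet> (A *v u)) - s * (u \<bullet> u) + s * (s * b)"
    unfolding b_def inner_diff_left inner_diff_right inner_scaleR_left inner_scaleR_right
    by (simp add: algebra_simps)
  also have "\<dots> = s * (s * b - 2 * (u \<bullet> u))"
    unfolding vAu using zero by (simp add: u_def[symmetric] algebra_simps)
  finally have "2 * (u \<bullet> u) \<le> s * b" using s by (simp add: zero_le_mult_iff)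
  moreover have "s * b \<le> u \<bullet> u"
    using b pos by (simp add: s_def field_simps)
  ultimately show False using pos by simp
qed

text \<open>By compactness the form has a maximum \<open>m\<close> on the unit sphere. Then
  \<open>m I - A\<close> is positive semidefinite and its form vanishes at the maximizer, which is
  therefore an eigenvector of \<open>A\<close> for \<open>m\<close>.\<close>

lemma Rayleigh_max:
  fixes A :: "real^'n^'n"
  assumes sym: "symmetric_matrix A"
  obtains m where "m \<in> eigenvalues A" "\<And>x. x \<bullet> (A *v x) \<le> m * (norm x)\<^sup>2"
proof -
  have "continuous_on (sphere 0 1) (\<lambda>x. x \<bullet> (A *v x))"
    by (intro continuous_intros linear_continuous_on matrix_vector_mul_bounded_linear)
  moreover have "sphere (0::real^'n) 1 \<noteq> {}"
    by (metis dist_0_norm empty_iff mem_sphere norm_axis_1)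
  ultimately obtain v where v: "norm v = 1"
    and max: "\<And>y. norm y = 1 \<Longrightarrow> y \<bullet> (A *v y) \<le> v \<bullet> (A *v v)"
    using continuous_attains_sup[of "sphere 0 1" "\<lambda>x. x \<bullet> (A *v x)"] by auto
  define m where "m = v \<bullet> (A *v v)"
  have bound: "x \<bullet> (A *v x) \<le> m * (norm x)\<^sup>2" for x
  proof (cases "x = 0")
    case False
    have "sgn x \<bullet> (A *v sgn x) \<le> m"
      unfolding m_def by (rule max) (simp add: False norm_sgn)
    then show ?thesis
      using False
      by (simp add: sgn_div_norm matrix_vector_mult_scaleR field_simps power2_eq_square)
  qed simp
  define B where "B = (-1) *\<^sub>R A + mat m"
  have B: "B *v x = m *\<^sub>R x - A *v x" for x
  proof -
    have "mat m *v x = m *\<^sub>R x"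
      by (simp add: vec_eq_iff matrix_vector_mult_def mat_def if_distrib[of "\<lambda>c. c * _"] cong: if_cong)
    then show ?thesis
      unfolding B_def matrix_vector_mult_add_rdistrib scaleR_matrix_vector_assoc[symmetric] by simp
  qed
  have "B *v v = 0"
  proof (rule semidefinite_null_vector)
    show "symmetric_matrix B"
      unfolding B_def by (rule symmetric_matrix_scaleR_add_mat[OF sym])
    show "x \<bullet> (B *v x) \<ge> 0" for x
      using bound[of x] by (simp add: B inner_diff_right power2_norm_eq_inner)
    show "v \<bullet> (B *v v) = 0"
      using v by (simp add: B inner_diff_right m_def dot_square_norm)
  qed
  then have "m \<in> eigenvalues A"
    using v by (auto simp: B eigenvalues_def intro!: exI[of _ v])
  with bound show thesis by (rule that[rotated])
qed

lemma Rayleigh_min: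
  fixes A :: "real^'n^'n"
  assumes sym: "symmetric_matrix A"
  obtains m where "m \<in> eigenvalues A" "\<And>x. m * (norm x)\<^sup>2 \<le> x \<bullet> (A *v x)"
proof -
  have neg: "((-1) *\<^sub>R A) *v x = - (A *v x)" for x
    unfolding scaleR_matrix_vector_assoc[symmetric] by simp
  have "symmetric_matrix ((-1) *\<^sub>R A)"
    using sym by (simp add: symmetric_matrix_def transpose_def vec_eq_iff)
  then obtain m where m: "m \<in> eigenvalues ((-1) *\<^sub>R A)"
    and le: "\<And>x. x \<bullet> (((-1) *\<^sub>R A) *v x) \<le> m * (norm x)\<^sup>2"
    using Rayleigh_max by blast
  have "- m \<in> eigenvalues A"
    using m unfolding eigenvalues_def neg by simp (metis minus_minus)
  moreover have "- m * (norm x)\<^sup>2 \<le> x \<bullet> (A *v x)" for x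
    using le[of x] unfolding neg by simp
  ultimately show thesis by (rule that)
qed

text \<open>Eigenvectors of a symmetric matrix for distinct eigenvalues are orthogonal, and a
  pairwise orthogonal set is finite. This gives \<open>Max\<close> and \<open>Min\<close> in
  \<open>lambda_max\<close> and \<open>lambda_min\<close> their intended meaning.\<close>

lemma finite_eigenvalues:
  fixes A :: "real^'n^'n"
  assumes sym: "symmetric_matrix A"
  shows "finite (eigenvalues A)"
proof -
  define f where "f l = (SOME v. v \<noteq> 0 \<and> A *v v = l *\<^sub>R v)" for l
  have f: "f l \<noteq> 0" "A *v f l = l *\<^sub>R f l" if "l \<in> eigenvalues A" for l
    using someI_ex[of "\<lambda>v. v \<noteq> 0 \<and> A *v v = l *\<^sub>R v"] that
    by (auto simp: eigenvalues_def f_def)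
  have orth: "f l \<bullet> f k = 0" if "l \<in> eigenvalues A" "k \<in> eigenvalues A" "l \<noteq> k" for l k
    using inner_symmetric_matrix[OF sym, of "f l" "f k"] that f
    by (simp add: inner_commute)
  have "inj_on f (eigenvalues A)"
    using orth f by (metis inj_onI inner_eq_zero_iff)
  moreover have "finite (f ` eigenvalues A)"
    using orth by (intro pairwise_orthogonal_imp_finite)
      (auto simp: pairwise_def orthogonal_def)
  ultimately show ?thesis by (rule finite_imageD[rotated])
qed

lemma quadratic_form_le_lambda_max:
  assumes "symmetric_matrix A"
  shows "x \<bullet> (A *v x) \<le> lambda_max A * (norm x)\<^sup>2"
proof -
  obtain m where m: "m \<in> eigenvalues A" "x \<bullet> (A *v x) \<le> m * (norm x)\<^sup>2"
    using Rayleigh_max[OF assms] by metis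
  have "m \<le> lambda_max A"
    unfolding lambda_max_def using finite_eigenvalues[OF assms] m(1) by (rule Max_ge)
  then have "m * (norm x)\<^sup>2 \<le> lambda_max A * (norm x)\<^sup>2" by (simp add: mult_right_mono)
  with m(2) show ?thesis by simp
qed

lemma quadratic_form_ge_lambda_min:
  assumes "symmetric_matrix A"
  shows "lambda_min A * (norm x)\<^sup>2 \<le> x \<bullet> (A *v x)"
proof -
  obtain m where m: "m \<in> eigenvalues A" "m * (norm x)\<^sup>2 \<le> x \<bullet> (A *v x)"
    using Rayleigh_min[OF assms] by metis
  have "lambda_min A \<le> m"
    unfolding lambda_min_def using finite_eigenvalues[OF assms] m(1) by (rule Min_le)
  then have "lambda_min A * (norm x)\<^sup>2 \<le> m * (norm x)\<^sup>2" by (simp add: mult_right_mono)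
  with m(2) show ?thesis by simp
qed

text \<open>The minimum is attained, so the form can be evaluated at an eigenvector for it.\<close>

lemma lambda_min_pos:
  assumes "positive_definite A"
  shows "lambda_min A > 0"
proof -
  have sym: "symmetric_matrix A" using assms by (simp add: positive_definite_def)
  have "eigenvalues A \<noteq> {}" using Rayleigh_min[OF sym] by blast
  then have "lambda_min A \<in> eigenvalues A"
    unfolding lambda_min_def using finite_eigenvalues[OF sym] by (intro Min_in)
  then obtain v where "v \<noteq> 0" "A *v v = lambda_min A *\<^sub>R v"
    by (auto simp: eigenvalues_def)
  then have "lambda_min A * (v \<bullet> v) > 0"
    using assms by (metis inner_scaleR_right positive_definite_def)
  then show ?thesis using zero_less_mult_pos2 \<open>v \<noteq> 0\<close> by (metis inner_gt_zero_iff)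
qed

text \<open>Definiteness forces a trivial kernel, so the matrix chosen by \<open>matrix_inv\<close>
  is a true inverse.\<close>

lemma positive_definite_mult_inverse:
  fixes A :: "real^'n^'n"
  assumes "positive_definite A"
  shows "A ** matrix_inv A = mat 1"
proof -
  have "x = 0" if "A *v x = 0" for x
    using assms that by (force simp: positive_definite_def)
  then have "invertible A"
    using invertible_left_inverse matrix_left_invertible_ker by blast
  then show ?thesis
    unfolding invertible_def matrix_inv_def by (rule someI_ex[THEN conjunct1])
qed

section \<open>Quadratic forms of block matrices and of the matrix inequality\<close>

lemma sum_UNIV_Plus:
  "sum f (UNIV :: ('a::finite + 'b::finite) set) = (\<Sum>i\<in>UNIV. f (Inl i)) + (\<Sum>i\<in>UNIV. f (Inr i))"
  by (simp add: UNIV_Plus_UNIV[symmetric] sum.Plus comp_def del: UNIV_Plus_UNIV)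

lemma star_block_quadratic_form:
  fixes x q :: "real^'n"
  defines "z \<equiv> \<chi> k. case k of Inl i \<Rightarrow> x $ i | Inr i \<Rightarrow> q $ i"
  shows "z \<bullet> (star_block A B C *v z) = x \<bullet> (A *v x) + 2 * (q \<bullet> (B *v x)) + q \<bullet> (C *v q)"
proof -
  have "z \<bullet> (star_block A B C *v z)
      = x \<bullet> (A *v x) + x \<bullet> (transpose B *v q) + (q \<bullet> (B *v x) + q \<bullet> (C *v q))"
    by (simp add: z_def star_block_def inner_vec_def matrix_vector_mult_def sum_UNIV_Plus
        distrib_left sum.distrib)
  also have "x \<bullet> (transpose B *v q) = q \<bullet> (B *v x)"
    by (simp add: inner_matrix_transpose inner_commute)
  finally show ?thesis by simp
qed

lemma negative_definite_star_block_le: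
  assumes "negative_definite (star_block A B C)"
  shows "x \<bullet> (A *v x) + 2 * (q \<bullet> (B *v x)) + q \<bullet> (C *v q) \<le> 0"
proof -
  have "z \<bullet> (star_block A B C *v z) \<le> 0" for z
    using assms by (cases "z = 0") (auto simp: negative_definite_def less_imp_le)
  then show ?thesis by (metis star_block_quadratic_form)
qed

text \<open>Symmetry of \<open>G\<close> merges all its occurrences into one bilinear term between
  \<open>transpose Z *v x\<close> and \<open>x - q\<close>. The other terms are independent of
  \<open>G\<close>, so a bound that holds at every vertex passes to the convex hull.\<close>

lemma LMI_quadratic_form:
  fixes G :: "real^'n^'n"
  assumes sym: "symmetric_matrix G"
  shows "x \<bullet> ((Z ** G + G ** transpose Z + (2 * \<eta>) *\<^sub>R P) *v x)
      + 2 * (q \<bullet> ((\<Lambda> - transpose Zaw - G ** transpose Z) *v x)) + q \<bullet> (((- 2) *\<^sub>R \<Lambda>) *v q)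
    = 2 * ((transpose Z *v x) \<bullet> (G *v (x - q))) + 2 * \<eta> * (x \<bullet> (P *v x))
      - 2 * (x \<bullet> (Zaw *v q)) + 2 * (q \<bullet> (\<Lambda> *v x)) - 2 * (q \<bullet> (\<Lambda> *v q))"
proof -
  have ZG: "x \<bullet> (Z *v (G *v y)) = (transpose Z *v x) \<bullet> (G *v y)" for y
    by (rule inner_matrix_transpose)
  have GZ: "y \<bullet> (G *v (transpose Z *v x)) = (transpose Z *v x) \<bullet> (G *v y)" for y
    by (rule inner_symmetric_matrix[OF sym])
  have "q \<bullet> (transpose Zaw *v x) = x \<bullet> (Zaw *v q)"
    by (simp add: inner_matrix_transpose inner_commute)
  then show ?thesis
    unfolding matrix_vector_mult_add_rdistrib matrix_vector_mult_diff_rdistrib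
      matrix_vector_mult_diff_distrib scaleR_matrix_vector_assoc[symmetric]
      matrix_vector_mul_assoc[symmetric] inner_add_right inner_diff_right inner_scaleR_right ZG GZ
    by simp
qed

lemma convex_bilinear_form_le:
  "convex {G :: real^'n^'m. u \<bullet> (G *v y) \<le> c}"
proof (rule convexI)
  fix G1 G2 :: "real^'n^'m" and s t :: real
  assume G: "G1 \<in> {G. u \<bullet> (G *v y) \<le> c}" "G2 \<in> {G. u \<bullet> (G *v y) \<le> c}"
    and st: "0 \<le> s" "0 \<le> t" "s + t = 1"
  have "s * (u \<bullet> (G1 *v y)) + t * (u \<bullet> (G2 *v y)) \<le> c"
    using G st by (intro convex_bound_le) auto
  then show "s *\<^sub>R G1 + t *\<^sub>R G2 \<in> {G. u \<bullet> (G *v y) \<le> c}"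
    by (simp add: matrix_vector_mult_add_rdistrib scaleR_matrix_vector_assoc[symmetric] inner_add_right)
qed

section \<open>The dead zone and its sector condition\<close>

lemma dead_zone_component:
  assumes "tb $ l > 0"
  shows "dead_zone tb th $ l
    = (if th $ l > tb $ l then th $ l - tb $ l else if th $ l < - (tb $ l) then th $ l + tb $ l else 0)"
  using assms by (auto simp: dead_zone_def sat_def sgn_if min_def)

text \<open>Where the dead zone is positive, the second factor is
  \<open>tb $ l - ts $ l > 0\<close>; where it is negative, that factor is
  \<open>- (tb $ l) - ts $ l < 0\<close>; elsewhere the product vanishes.\<close>

lemma dead_zone_sector:
  assumes "\<bar>ts $ l\<bar> < tb $ l"
  shows "dead_zone tb (x + ts) $ l * (x $ l - dead_zone tb (x + ts) $ l) \<ge> 0"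
proof -
  have "tb $ l > 0" using assms by linarith
  then show ?thesis
    using assms by (auto simp: dead_zone_component zero_le_mult_iff)
qed

lemma positive_definite_diagonal_pos:
  assumes "positive_definite A"
  shows "A $ i $ i > 0"
proof -
  have "axis i 1 \<bullet> (A *v axis i 1) > 0"
    using assms by (simp add: positive_definite_def axis_eq_0_iff)
  then show ?thesis
    by (simp add: inner_axis' matrix_vector_mult_basis column_def)
qed

lemma diagonal_sector_nonneg:
  fixes \<Lambda> :: "real^'n^'n"
  assumes diag: "diagonal_matrix \<Lambda>" and pos: "positive_definite \<Lambda>"
    and sector: "\<And>l. q $ l * y $ l \<ge> 0"
  shows "q \<bullet> (\<Lambda> *v y) \<ge> 0"
proof -
  have "(\<Lambda> *v y) $ l = \<Lambda> $ l $ l * y $ l" for l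
  proof -
    have "(\<Lambda> *v y) $ l = (\<Sum>j\<in>UNIV. if j = l then \<Lambda> $ l $ l * y $ l else 0)"
      unfolding matrix_vector_mult_def vec_lambda_beta
      using diag by (intro sum.cong) (auto simp: diagonal_matrix_def)
    then show ?thesis by simp
  qed
  then have "q \<bullet> (\<Lambda> *v y) = (\<Sum>l\<in>UNIV. \<Lambda> $ l $ l * (q $ l * y $ l))"
    by (simp add: inner_vec_def ac_simps)
  also have "\<dots> \<ge> 0"
    using sector positive_definite_diagonal_pos[OF pos]
    by (intro sum_nonneg) (metis less_imp_le mult_nonneg_nonneg)
  finally show ?thesis .
qed

section \<open>Quadratic Lyapunov functions and exponential decay\<close>

lemma quadratic_Lyapunov_decay:
  fixes P :: "real^'n^'n"
  assumes sym: "symmetric_matrix P"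
    and decay: "\<And>y. y \<bullet> (P *v f y) \<le> - \<eta> * (y \<bullet> (P *v y))"
    and J: "is_interval J" "0 \<in> J" "J \<subseteq> {0..}" and ode: "solves_autonomous_ode f x J"
    and t: "t \<in> J"
  shows "x t \<bullet> (P *v x t) \<le> exp (- 2 * \<eta> * t) * (x 0 \<bullet> (P *v x 0))"
proof -
  \<comment> \<open>The exponential weight turns the decay inequality
    \<open>V' \<le> - 2 \<eta> V\<close> into monotonicity: \<open>g'\<close> is the weight times
    \<open>2 \<eta> V + V'\<close>.\<close>
  define g where "g s = exp (2 * \<eta> * s) * (x s \<bullet> (P *v x s))" for s
  define g' where "g' s = exp (2 * \<eta> * s)
    * (2 * \<eta> * (x s \<bullet> (P *v x s)) + 2 * (x s \<bullet> (P *v f (x s))))" for s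
  have t0: "0 \<le> t" using t J by auto
  \<comment> \<open>Since \<open>J\<close> is an interval, the solution can be restricted to
    \<open>{0..t}\<close>, where the mean value theorem applies.\<close>
  have sub: "{0..t} \<subseteq> J"
    by (meson J(1,2) t atLeastAtMost_iff mem_is_interval_1_I subsetI)
  have der: "(g has_real_derivative g' s) (at s within {0..t})" if "s \<in> {0..t}" for s
  proof -
    have x: "(x has_vector_derivative f (x s)) (at s within {0..t})"
      using ode sub that unfolding solves_autonomous_ode_def
      by (meson has_vector_derivative_within_subset subsetD)
    have Px: "((\<lambda>s. P *v x s) has_vector_derivative P *v f (x s)) (at s within {0..t})"
      by (rule bounded_linear.has_vector_derivative[OF matrix_vector_mul_bounded_linear x])
    have V: "((\<lambda>s. x s \<bullet> (P *v x s)) has_real_derivative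
        x s \<bullet> (P *v f (x s)) + f (x s) \<bullet> (P *v x s)) (at s within {0..t})"
      using bounded_bilinear.has_vector_derivative[OF bounded_bilinear_inner x Px]
      by (simp add: has_real_derivative_iff_has_vector_derivative)
    show ?thesis
      unfolding g_def g'_def
      by (rule derivative_eq_intros V refl)+
        (simp add: inner_symmetric_matrix[OF sym, of "f (x s)"] algebra_simps)
  qed
  have "\<exists>s\<in>{0..t}. g t - g 0 = g' s * (t - 0)"
    using t0 der by (intro mvt_very_simple) (auto simp: has_field_derivative_def)
  then obtain s where s: "g t - g 0 = g' s * t" by auto
  have "g' s \<le> 0"
    unfolding g'_def using decay[of "x s"] by (intro mult_nonneg_nonpos) auto
  then have "g t \<le> g 0" using s t0 mult_nonpos_nonneg[of "g' s" t] by linarith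
  then show ?thesis
    by (simp add: g_def exp_minus field_simps)
qed

text \<open>The smallest eigenvalue bounds the form from below at time \<open>t\<close>, the largest
  bounds it from above at time 0; the square root of their ratio is the overshoot constant.\<close>

lemma exponential_stability_of_quadratic_Lyapunov:
  fixes P :: "real^'n^'n"
  assumes P: "positive_definite P" and "f 0 = 0"
    and decay: "\<And>y. y \<bullet> (P *v f y) \<le> - \<eta> * (y \<bullet> (P *v y))"
  shows "origin_globally_exponentially_stable f (sqrt (lambda_max P / lambda_min P)) \<eta>"
  unfolding origin_globally_exponentially_stable_def
proof (intro conjI allI impI ballI; (elim conjE)?)
  show "f 0 = 0" by fact
next
  fix x J t
  assume J: "is_interval J" "0 \<in> J" "J \<subseteq> {0..}" "solves_autonomous_ode f x J" and t: "t \<in> J"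
  have sym: "symmetric_matrix P" using P by (simp add: positive_definite_def)
  have pos: "lambda_min P > 0" by (rule lambda_min_pos[OF P])
  have "lambda_min P * (norm (x t))\<^sup>2 \<le> x t \<bullet> (P *v x t)"
    by (rule quadratic_form_ge_lambda_min[OF sym])
  also have "\<dots> \<le> exp (- 2 * \<eta> * t) * (x 0 \<bullet> (P *v x 0))"
    by (rule quadratic_Lyapunov_decay[OF sym decay J t])
  also have "\<dots> \<le> exp (- 2 * \<eta> * t) * (lambda_max P * (norm (x 0))\<^sup>2)"
    by (intro mult_left_mono quadratic_form_le_lambda_max[OF sym]) simp
  also have "exp (- 2 * \<eta> * t) = (exp (- \<eta> * t))\<^sup>2"
    by (simp add: power2_eq_square flip: exp_add)
  finally have "(norm (x t))\<^sup>2 \<le> lambda_max P / lambda_min P * (exp (- \<eta> * t) * norm (x 0))\<^sup>2"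
    using pos by (simp add: field_simps power_mult_distrib)
  then have "norm (x t) \<le> sqrt (lambda_max P / lambda_min P * (exp (- \<eta> * t) * norm (x 0))\<^sup>2)"
    by (rule real_le_rsqrt)
  then show "norm (x t) \<le> sqrt (lambda_max P / lambda_min P) * exp (- \<eta> * t) * norm (x 0)"
    by (simp only: real_sqrt_mult real_sqrt_abs abs_mult abs_exp_cancel abs_norm_cancel mult.assoc)
qed

theorem lemma2:
  fixes H P \<Lambda> Z Zaw :: "real^'n^'n"
    and Hs :: "nat \<Rightarrow> real^'n^'n"
    and N :: nat
    and ts tb a wi :: "real^'n"
    and w \<eta> :: real
  assumes H_symmetric: "symmetric_matrix H"
    and amplitudes: "\<And>i. a $ i \<noteq> 0"
    and bounds_positive: "\<And>l. tb $ l > 0"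
    and extremum_inside: "\<And>l. \<bar>ts $ l\<bar> < tb $ l"
    and w_positive: "w > 0"
    and frequencies: "admissible_frequencies w wi"
    and vertices_symmetric: "\<And>i. i \<in> {1..N} \<Longrightarrow> symmetric_matrix (Hs i)"
    and H_polytope: "H \<in> convex hull (Hs ` {1..N})"
    and eta_positive: "\<eta> > 0"
    and P: "positive_definite P"
    and \<Lambda>: "diagonal_matrix \<Lambda>" "positive_definite \<Lambda>"
    and LMI: "\<And>i. i \<in> {1..N} \<Longrightarrow>
      negative_definite (star_block
        (Z ** Hs i + Hs i ** transpose Z + (2 * \<eta>) *\<^sub>R P)
        (\<Lambda> - transpose Zaw - Hs i ** transpose Z)
        ((- 2) *\<^sub>R \<Lambda>))"
  shows "origin_globally_exponentially_stable
      (esc_average_field H ts tb (matrix_inv P ** Z) (matrix_inv P ** Zaw))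
      (sqrt (lambda_max P / lambda_min P)) \<eta>"
proof (rule exponential_stability_of_quadratic_Lyapunov[OF P])
  let ?f = "esc_average_field H ts tb (matrix_inv P ** Z) (matrix_inv P ** Zaw)"
  \<comment> \<open>The extremum lies inside the saturation bounds, which makes the origin an
    equilibrium.\<close>
  have "dead_zone tb ts = 0"
    using extremum_inside bounds_positive
    by (auto simp: vec_eq_iff dead_zone_component abs_less_iff not_less minus_less_iff less_imp_le)
  then show "?f 0 = 0" by (simp add: esc_average_field_def)
  fix y
  define q where "q = dead_zone tb (y + ts)"
  have field: "?f y = matrix_inv P *v (Z *v (H *v (y - q)) - Zaw *v q)"
    by (simp add: esc_average_field_def q_def matrix_vector_mult_diff_distrib
        flip: matrix_vector_mul_assoc)
  have "P *v ?f y = Z *v (H *v (y - q)) - Zaw *v q"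
    unfolding field matrix_vector_mul_assoc positive_definite_mult_inverse[OF P] by simp
  then have deriv: "y \<bullet> (P *v ?f y) = (transpose Z *v y) \<bullet> (H *v (y - q)) - y \<bullet> (Zaw *v q)"
    by (simp add: inner_diff_right inner_matrix_transpose)
  \<comment> \<open>Half of what remains of the quadratic form, moved to the right-hand side, once
    the term in the Hessian is isolated; it is the same for all vertices.\<close>
  define c where "c = y \<bullet> (Zaw *v q) - \<eta> * (y \<bullet> (P *v y)) - q \<bullet> (\<Lambda> *v y) + q \<bullet> (\<Lambda> *v q)"
  have "Hs ` {1..N} \<subseteq> {G. (transpose Z *v y) \<bullet> (G *v (y - q)) \<le> c}"
  proof clarify
    fix i assume i: "i \<in> {1..N}"
    show "(transpose Z *v y) \<bullet> (Hs i *v (y - q)) \<le> c"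
      using negative_definite_star_block_le[OF LMI[OF i], of y q]
      unfolding LMI_quadratic_form[OF vertices_symmetric[OF i]] c_def by linarith
  qed
  then have "convex hull (Hs ` {1..N}) \<subseteq> {G. (transpose Z *v y) \<bullet> (G *v (y - q)) \<le> c}"
    by (intro hull_minimal convex_bilinear_form_le)
  then have "(transpose Z *v y) \<bullet> (H *v (y - q)) \<le> c"
    using H_polytope by blast
  moreover have "q \<bullet> (\<Lambda> *v (y - q)) \<ge> 0"
    using dead_zone_sector[OF extremum_inside]
    by (intro diagonal_sector_nonneg \<Lambda>) (simp add: q_def)
  ultimately show "y \<bullet> (P *v ?f y) \<le> - \<eta> * (y \<bullet> (P *v y))"
    unfolding deriv c_def by (simp add: matrix_vector_mult_diff_distrib inner_diff_right)
qed

end
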